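(* For a positive integer $n$, let $s(2n)$ denote the maximal value of the nil-index $s(\mathfrak g)$ of a $2n$-dimensional real nilpotent Lie algebra $\mathfrak g$ that admits a complex structure. Then the following estimates hold: $$\left[\frac{4n}{3}\right]\le s(2n)\le 2n-2 .$$
   Context: For a Lie algebra $\mathfrak g$ the descending central series is $\mathfrak g^1=\mathfrak g$, $\mathfrak g^k=[\mathfrak g,\mathfrak g^{k-1}]$ for $k\ge 2$. A Lie algebra $\mathfrak g$ is nilpotent if there is a natural number $s(\mathfrak g)$, called its nil-index, with $\mathfrak g^{s(\mathfrak g)}\ne 0$ and $\mathfrak g^{s(\mathfrak g)+1}=0$ (so an abelian Lie algebra is regarded as $1$-step nilpotent). A complex structure on a real Lie algebra $\mathfrak g$ is a linear endomorphism $J$ of $\mathfrak g$ with $J^2=-1$ satisfying the integrability condition $[JX,JY]=[X,Y]+J[JX,Y]+J[X,JY]$ for all $X,Y\in\mathfrak g$. $[x]$ denotes the integer part of a real number $x$.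
   Formalization: The upper bound s(2n) ≤ 2n−2 is stated only for n ≥ 2, since for n = 1 it fails: the abelian algebra R² admits a complex structure and has nil-index 1 > 0; the lower bound is kept for all n ≥ 1. *)

theory Defs
  imports "HOL-Analysis.Analysis" "HOL-Analysis.Finite_Function_Topology"
begin

(* A real Lie algebra is a subspace L of some ambient real vector space together with a bracket;
   the values of the bracket (and, below, of J) outside L are irrelevant. *)
locale real_lie_algebra =
  fixes L :: "'a::real_vector set" and br :: "'a \<Rightarrow> 'a \<Rightarrow> 'a"
  assumes subspace_carrier: "subspace L"
    and bracket_closed: "\<And>x y. \<lbrakk>x \<in> L; y \<in> L\<rbrakk> \<Longrightarrow> br x y \<in> L"
    and bracket_add_left: "\<And>x y z. \<lbrakk>x \<in> L; y \<in> L; z \<in> L\<rbrakk> \<Longrightarrow> br (x + y) z = br x z + br y z"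
    and bracket_add_right: "\<And>x y z. \<lbrakk>x \<in> L; y \<in> L; z \<in> L\<rbrakk> \<Longrightarrow> br x (y + z) = br x y + br x z"
    and bracket_scaleR_left: "\<And>c x y. \<lbrakk>x \<in> L; y \<in> L\<rbrakk> \<Longrightarrow> br (c *\<^sub>R x) y = c *\<^sub>R br x y"
    and bracket_scaleR_right: "\<And>c x y. \<lbrakk>x \<in> L; y \<in> L\<rbrakk> \<Longrightarrow> br x (c *\<^sub>R y) = c *\<^sub>R br x y"
    and bracket_self: "\<And>x. x \<in> L \<Longrightarrow> br x x = 0"
    and jacobi: "\<And>x y z. \<lbrakk>x \<in> L; y \<in> L; z \<in> L\<rbrakk> \<Longrightarrow>
      br x (br y z) + br y (br z x) + br z (br x y) = 0"

definition bracket_span :: "('a::real_vector \<Rightarrow> 'a \<Rightarrow> 'a) \<Rightarrow> 'a set \<Rightarrow> 'a set \<Rightarrow> 'a set" where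
  "bracket_span br A B = span {br x y | x y. x \<in> A \<and> y \<in> B}"

(* The series is indexed from 1; the term with index 0 is a dummy, set to L so that a nonzero
   algebra cannot have nil-index 0. *)
fun lower_central :: "'a::real_vector set \<Rightarrow> ('a \<Rightarrow> 'a \<Rightarrow> 'a) \<Rightarrow> nat \<Rightarrow> 'a set" where
  "lower_central L br 0 = L"
| "lower_central L br (Suc 0) = L"
| "lower_central L br (Suc (Suc k)) = bracket_span br L (lower_central L br (Suc k))"

definition has_nil_index :: "'a::real_vector set \<Rightarrow> ('a \<Rightarrow> 'a \<Rightarrow> 'a) \<Rightarrow> nat \<Rightarrow> bool" where
  "has_nil_index L br s \<longleftrightarrow> lower_central L br s \<noteq> {0} \<and> lower_central L br (s + 1) = {0}"

definition nilpotent_lie :: "'a::real_vector set \<Rightarrow> ('a \<Rightarrow> 'a \<Rightarrow> 'a) \<Rightarrow> bool" where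
  "nilpotent_lie L br \<longleftrightarrow> (\<exists>s. has_nil_index L br s)"

definition nil_index :: "'a::real_vector set \<Rightarrow> ('a \<Rightarrow> 'a \<Rightarrow> 'a) \<Rightarrow> nat" where
  "nil_index L br = (THE s. has_nil_index L br s)"

locale complex_structure =
  fixes L :: "'a::real_vector set" and br :: "'a \<Rightarrow> 'a \<Rightarrow> 'a" and J :: "'a \<Rightarrow> 'a"
  assumes closed: "\<And>x. x \<in> L \<Longrightarrow> J x \<in> L"
    and add: "\<And>x y. \<lbrakk>x \<in> L; y \<in> L\<rbrakk> \<Longrightarrow> J (x + y) = J x + J y"
    and scaleR: "\<And>c x. x \<in> L \<Longrightarrow> J (c *\<^sub>R x) = c *\<^sub>R J x"
    and square: "\<And>x. x \<in> L \<Longrightarrow> J (J x) = - x"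
    and integrable: "\<And>x y. \<lbrakk>x \<in> L; y \<in> L\<rbrakk> \<Longrightarrow>
      br (J x) (J y) = br x y + J (br (J x) y) + J (br x (J y))"

(* Nil-indices of the m-dimensional algebras with ambient space 'a. For m > 0 the condition
   dim L = m includes finite-dimensionality, as dim is 0 for infinite-dimensional subspaces. *)
definition nil_indices :: "'a::real_vector itself \<Rightarrow> nat \<Rightarrow> nat set" where
  "nil_indices _ m = {nil_index L br | (L :: 'a set) br.
     real_lie_algebra L br \<and> dim L = m \<and> nilpotent_lie L br \<and> (\<exists>J. complex_structure L br J)}"

(* The finitely supported real sequences contain a copy of every finite-dimensional real vector
   space, so this ambient space yields all isomorphism classes: see nil_indices_subset. *)
definition max_nil_index :: "nat \<Rightarrow> nat" where
  "max_nil_index m = Max (nil_indices TYPE(nat \<Rightarrow>\<^sub>0 real) m)"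

lemma lower_central_subset:
  assumes "real_lie_algebra L br"
  shows "lower_central L br k \<subseteq> L"
  using assms
proof (induction L br k rule: lower_central.induct)
  case (3 L br k)
  interpret real_lie_algebra L br by fact
  show ?case
    unfolding bracket_span_def lower_central.simps
    using 3 bracket_closed by (intro span_minimal subspace_carrier) auto
qed auto

lemma independent_single: "independent (range (\<lambda>k. Poly_Mapping.single k (1::real)))"
proof -
  have *: "Poly_Mapping.lookup x k = 0"
    if "x \<in> span (range (\<lambda>k. Poly_Mapping.single k (1::real)) - {Poly_Mapping.single k 1})"
    for x :: "'a \<Rightarrow>\<^sub>0 real" and k
    using that
  proof (induction rule: span_induct)
    case base
    have "Poly_Mapping.lookup (c *\<^sub>R y) k = c * Poly_Mapping.lookup y k"
      for c and y :: "'a \<Rightarrow>\<^sub>0 real"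
    proof -
      have "finite {i. c * Poly_Mapping.lookup y i \<noteq> 0}"
        by (rule finite_subset[OF _ finite_keys[of y]]) (auto simp: in_keys_iff)
      then show ?thesis by (simp add: scaleR_poly_mapping_def)
    qed
    then show ?case by (simp add: subspace_def lookup_add)
  next
    case step
    then show ?case by (auto simp: lookup_single when_def)
  qed
  show ?thesis
    unfolding dependent_def using * by fastforce
qed

lemma embed_finite_dimensional:
  fixes L :: "'a::real_vector set"
  assumes "subspace L" "dim L > 0"
  obtains f :: "'a \<Rightarrow> nat \<Rightarrow>\<^sub>0 real" where "linear f" "inj_on f L"
proof -
  obtain B where B: "B \<subseteq> L" "independent B" "L \<subseteq> span B" "card B = dim L"
    using basis_exists by blast
  have "finite B" using assms B by (metis card.infinite less_nat_zero_code)
  then obtain h :: "'a \<Rightarrow> nat" where h: "inj_on h B"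
    using finite_imp_inj_to_nat_seg by blast
  obtain f :: "'a \<Rightarrow> nat \<Rightarrow>\<^sub>0 real"
    where f: "linear f" "\<And>b. b \<in> B \<Longrightarrow> f b = Poly_Mapping.single (h b) 1"
    using linear_independent_extend[OF B(2), of "\<lambda>b. Poly_Mapping.single (h b) 1"] by blast
  have "inj_on f B"
  proof (rule inj_onI)
    fix x y assume xy: "x \<in> B" "y \<in> B" "f x = f y"
    then have "Poly_Mapping.lookup (Poly_Mapping.single (h x) (1::real)) (h x)
      = Poly_Mapping.lookup (Poly_Mapping.single (h y) 1) (h x)"
      by (simp only: f(2))
    then have "h x = h y" by (simp add: lookup_single when_def split: if_splits)
    then show "x = y" using h xy by (auto dest: inj_onD)
  qed
  moreover have "independent (f ` B)"
    by (rule independent_mono[OF independent_single]) (auto simp: f(2))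
  ultimately have "inj_on f (span B)"
    using linear_inj_on_span_iff_independent_image[OF f(1)] by blast
  then show ?thesis using that f(1) B(3) inj_on_subset by blast
qed

lemma nil_indices_subset:
  assumes "m > 0"
  shows "nil_indices TYPE('a::real_vector) m \<subseteq> nil_indices TYPE(nat \<Rightarrow>\<^sub>0 real) m"
proof
  fix s assume "s \<in> nil_indices TYPE('a) m"
  then obtain L :: "'a set" and br J where
    s: "s = nil_index L br" and L: "real_lie_algebra L br" "dim L = m" "nilpotent_lie L br"
    and J: "complex_structure L br J"
    by (auto simp: nil_indices_def)
  interpret real_lie_algebra L br by fact
  interpret J: complex_structure L br J by fact
  obtain f :: "'a \<Rightarrow> nat \<Rightarrow>\<^sub>0 real" where f: "linear f" "inj_on f L"
    using embed_finite_dimensional subspace_carrier L(2) assms by metis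
  note lin = linear_add[OF f(1)] linear_scale[OF f(1)]
  note mem = subspace_add[OF subspace_carrier] subspace_scale[OF subspace_carrier]
    subspace_0[OF subspace_carrier]
  define g where "g = inv_into L f"
  define br' where "br' = (\<lambda>u v. f (br (g u) (g v)))"
  define J' where "J' = (\<lambda>u. f (J (g u)))"
  have g [simp]: "g (f x) = x" if "x \<in> L" for x
    using that f(2) by (simp add: g_def)
  have br' [simp]: "br' (f x) (f y) = f (br x y)" if "x \<in> L" "y \<in> L" for x y
    using that by (simp add: br'_def)
  have J' [simp]: "J' (f x) = f (J x)" if "x \<in> L" for x
    using that by (simp add: J'_def)
  note hom = lin[symmetric] mem bracket_closed J.closed
  have lie: "real_lie_algebra (f ` L) br'"
  proof
    show "subspace (f ` L)"
      using f(1) subspace_carrier by (rule linear_subspace_image)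
    show "br' u u = 0" if "u \<in> f ` L" for u
      using that by (auto simp: bracket_self linear_0[OF f(1)])
    show "br' u (br' v w) + br' v (br' w u) + br' w (br' u v) = 0"
      if uvw: "u \<in> f ` L" "v \<in> f ` L" "w \<in> f ` L" for u v w
    proof -
      obtain x y z where [simp]: "u = f x" "v = f y" "w = f z" and xyz: "x \<in> L" "y \<in> L" "z \<in> L"
        using uvw by blast
      show ?thesis
        using xyz jacobi[OF xyz] by (simp add: hom linear_0[OF f(1)])
    qed
  qed (auto simp: hom bracket_add_left bracket_add_right bracket_scaleR_left bracket_scaleR_right)
  have cs: "complex_structure (f ` L) br' J'"
    by unfold_locales
      (auto simp: hom J.add J.scaleR J.square J.integrable linear_neg[OF f(1)])
  have dim: "dim (f ` L) = m"
  proof -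
    obtain B where B: "B \<subseteq> L" "independent B" "L \<subseteq> span B" "card B = dim L"
      using basis_exists by blast
    have span: "span B = L"
      using B subspace_carrier by (meson antisym span_minimal)
    have "independent (f ` B)"
      using linear_independent_injective_image[OF f(1) B(2)] span f(2) by simp
    moreover have "span (f ` B) = f ` L"
      using linear_span_image[OF f(1)] span by simp
    moreover have "card (f ` B) = m"
      using B f(2) L(2) by (metis card_image inj_on_subset)
    ultimately show ?thesis by (metis dim_eq_card_independent dim_span)
  qed
  have lc: "lower_central (f ` L) br' k = f ` lower_central L br k" for k
  proof (induction k rule: less_induct)
    case (less k)
    consider "k = 0" | "k = Suc 0" | j where "k = Suc (Suc j)"
      by (metis not0_implies_Suc)
    then show ?case
    proof cases
      case 3
      have sub: "lower_central L br (Suc j) \<subseteq> L" by (rule lower_central_subset[OF L(1)])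
      have "br' (f x) (f y) = f (br x y)" if "x \<in> L" "y \<in> lower_central L br (Suc j)" for x y
        using that sub by (intro br') auto
      then have "{br' u v | u v. u \<in> f ` L \<and> v \<in> f ` lower_central L br (Suc j)}
          = f ` {br x y | x y. x \<in> L \<and> y \<in> lower_central L br (Suc j)}"
        by (auto simp: image_iff) metis+
      then show ?thesis
        using less.IH[of "Suc j"] 3 by (simp add: bracket_span_def linear_span_image[OF f(1)])
    qed auto
  qed
  have "f ` lower_central L br k = {0} \<longleftrightarrow> lower_central L br k = {0}" for k
  proof -
    have "f ` lower_central L br k = f ` {0} \<longleftrightarrow> lower_central L br k = {0}"
      using lower_central_subset[OF L(1)] mem(3) by (intro inj_on_image_eq_iff[OF f(2)]) auto
    then show ?thesis by (simp add: linear_0[OF f(1)])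
  qed
  then have "has_nil_index (f ` L) br' = has_nil_index L br"
    by (auto simp: has_nil_index_def lc fun_eq_iff)
  then have "nilpotent_lie (f ` L) br'" "s = nil_index (f ` L) br'"
    using L(3) s by (simp_all add: nilpotent_lie_def nil_index_def)
  then show "s \<in> nil_indices TYPE(nat \<Rightarrow>\<^sub>0 real) m"
    unfolding nil_indices_def using lie dim cs by blast
qed

end

theory Submission
  imports Defs
begin

text \<open>
  Upper bound: nil-index \<open>s = 2n - 1\<close> forces every step of the descending central series after the
  first to have codimension one. Let \<open>W\<^sub>k\<close> consist of the \<open>y\<close> with \<open>y, Jy \<in> \<gg>\<^sup>k\<close>. Integrability says
  that \<open>y \<in> W\<^sub>k\<close> gives \<open>[x,y] - [Jx,Jy] \<in> W\<^bsub>k+1\<^esub>\<close>, so at the last \<open>k\<close> with \<open>W\<^sub>k \<noteq> 0\<close> we have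
  \<open>[Jx,Jy] = [x,y]\<close> for all \<open>x\<close>. For \<open>k \<ge> 2\<close> we may assume \<open>y \<notin> \<gg>\<^bsup>k+1\<^esup>\<close>, and \<open>Jy \<equiv> \<lambda>y\<close> modulo
  \<open>\<gg>\<^bsup>k+1\<^esup>\<close> yields \<open>(1 + \<lambda>\<^sup>2)[x,y] \<in> \<gg>\<^bsup>k+2\<^esup>\<close>, so the series stabilises too early (and for \<open>k = s\<close>
  already \<open>Jy = \<lambda>y\<close> is impossible). For \<open>k = 1\<close> the
  centre is \<open>J\<close>-invariant, so some central \<open>Jz\<close> lies outside \<open>\<gg>\<^sup>2\<close>; together with one further
  element it generates \<open>\<gg>\<close>, which is then abelian modulo \<open>\<gg>\<^sup>3\<close>.

  Lower bound: truncate the loop algebra of \<open>so(3) = \<langle>u,v,w\<rangle>\<close> to odd powers of \<open>t\<close> for \<open>u, v\<close> and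
  positive even powers for \<open>w\<close>. Its degrees have dimensions 2, 1, 2, 1, ..., and \<open>J\<close> maps \<open>u t\<^sup>k\<close> to
  \<open>v t\<^sup>k\<close> and pairs up the \<open>w t\<^sup>k\<close>: as \<open>ad w\<close> acts by \<open>\<i>\<close> on \<open>u - \<i>v\<close>, the (1,0)-vectors form a
  subalgebra.
\<close>

subsection \<open>Filiform algebras\<close>

text \<open>The ambient type may be infinite-dimensional, and \<open>dim\<close> is 0 on
  infinite-dimensional subspaces; hence the finite spanning set. A basis of \<open>V\<close> stays
  independent when a vector of \<open>W\<close> outside \<open>V\<close> is added.\<close>

lemma dim_psubset_finite_span:
  fixes V W :: "'a::real_vector set"
  assumes "subspace V" "V \<subset> W" "finite F" "W \<subseteq> span F"
  shows "dim V < dim W"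
proof -
  obtain A where A: "A \<subseteq> V" "independent A" "V \<subseteq> span A" "card A = dim V"
    using basis_exists by blast
  obtain B where B: "B \<subseteq> W" "independent B" "W \<subseteq> span B" "card B = dim W"
    using basis_exists by blast
  obtain x where x: "x \<in> W" "x \<notin> V" using assms(2) by blast
  have fin: "finite A" "finite B"
    using independent_span_bound[OF assms(3)] A(1,2) B(1,2) assms(2,4) by blast+
  have "span A \<subseteq> V" using A(1) assms(1) by (rule span_minimal)
  then have "x \<notin> span A" using x by blast
  then have "independent (insert x A)" using A(2) by (simp add: independent_insert)
  moreover have "insert x A \<subseteq> span B" using x A(1) B(3) assms(2) by blast
  ultimately have "card (insert x A) \<le> card B"
    using independent_span_bound[OF fin(2)] by blast
  moreover have "x \<notin> A" using x A(1) by blast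
  ultimately show ?thesis using fin(1) A(4) B(4) by simp
qed

lemma finite_span_if_dim_pos:
  fixes L :: "'a::real_vector set"
  assumes "dim L > 0"
  obtains F where "finite F" "L \<subseteq> span F"
proof -
  obtain B where B: "L \<subseteq> span B" "card B = dim L"
    using basis_exists by blast
  then show ?thesis using assms that by (metis card.infinite less_nat_zero_code)
qed

lemma span_insert_psubset:
  assumes "y \<notin> V"
  shows "V \<subset> span (insert y V)"
  using assms span_superset[of "insert y V"] by blast

lemma mem_span_insert_subspace:
  assumes "subspace V" "v \<in> span (insert y V)"
  obtains c w where "w \<in> V" "v = c *\<^sub>R y + w"
proof -
  obtain c where "v - c *\<^sub>R y \<in> span V" using assms(2) by (auto simp: span_insert)
  then have "v - c *\<^sub>R y \<in> V" using assms(1) by (simp only: span_eq_iff[THEN iffD2])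
  then show ?thesis using that[of "v - c *\<^sub>R y" c] by simp
qed

section \<open>Descending central series and dimension counts\<close>

context real_lie_algebra
begin

abbreviation lc :: "nat \<Rightarrow> 'a set" where
  "lc \<equiv> lower_central L br"

lemma lc_Suc: "k \<ge> 1 \<Longrightarrow> lc (Suc k) = bracket_span br L (lc k)"
  by (cases k) auto

lemma subspace_lc: "subspace (lc k)"
proof (cases "k \<le> 1")
  case True
  then show ?thesis using subspace_carrier by (cases k) auto
next
  case False
  then show ?thesis by (cases k) (auto simp: lc_Suc bracket_span_def)
qed

lemmas lc_subset = lower_central_subset[OF real_lie_algebra_axioms]

lemma lc_mem: "x \<in> lc k \<Longrightarrow> x \<in> L"
  using lc_subset by blast

lemmas lc_closed =
  subspace_add[OF subspace_lc] subspace_diff[OF subspace_lc]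
  subspace_scale[OF subspace_lc] subspace_neg[OF subspace_lc]

lemmas carrier_closed =
  subspace_add[OF subspace_carrier] subspace_scale[OF subspace_carrier]
  subspace_neg[OF subspace_carrier] subspace_0[OF subspace_carrier]

lemma zero_mem_lc: "0 \<in> lc k"
  by (rule subspace_0[OF subspace_lc])

lemma bracket_antisym: "x \<in> L \<Longrightarrow> y \<in> L \<Longrightarrow> br x y = - br y x"
proof -
  assume xy: "x \<in> L" "y \<in> L"
  have "br (x + y) (x + y) = br x y + br y x"
    using xy bracket_self[of x] bracket_self[of y]
    by (simp add: bracket_add_left bracket_add_right carrier_closed)
  moreover have "br (x + y) (x + y) = 0"
    using xy by (intro bracket_self carrier_closed)
  ultimately show ?thesis by (simp add: eq_neg_iff_add_eq_0)
qed

lemma bracket_lc: "k \<ge> 1 \<Longrightarrow> x \<in> L \<Longrightarrow> y \<in> lc k \<Longrightarrow> br x y \<in> lc (Suc k)"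
  by (subst lc_Suc) (auto simp: bracket_span_def intro: span_base)

lemma lc_Suc_le:
  assumes "k \<ge> 1" "subspace V" "\<And>x y. x \<in> L \<Longrightarrow> y \<in> lc k \<Longrightarrow> br x y \<in> V"
  shows "lc (Suc k) \<subseteq> V"
  unfolding lc_Suc[OF assms(1)] bracket_span_def
  using assms by (intro span_minimal) auto

lemma lc_Suc_subset: "lc (Suc k) \<subseteq> lc k"
proof (induction k)
  case (Suc k)
  show ?case
  proof (cases "k = 0")
    case True
    then show ?thesis using lc_subset[of 2] by (simp add: numeral_2_eq_2)
  next
    case False
    with Suc show ?thesis
      by (intro lc_Suc_le subspace_lc) (auto intro: bracket_lc)
  qed
qed auto

lemma lc_antimono: "i \<le> j \<Longrightarrow> lc j \<subseteq> lc i"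
  by (rule lift_Suc_antimono_le[of lc, OF lc_Suc_subset])

text \<open>Bracketing an inclusion with \<open>L\<close> raises both indices by one, so equality of
  two successive terms propagates.\<close>

lemma lc_stationary:
  assumes "k \<ge> 1" "lc k \<subseteq> lc (Suc k)" "k \<le> j"
  shows "lc k \<subseteq> lc j"
  using assms(3)
proof (induction rule: dec_induct)
  case (step j)
  have "lc (Suc k) \<subseteq> lc (Suc j)"
    using step assms(1) by (intro lc_Suc_le subspace_lc) (auto intro: bracket_lc)
  then show ?case using assms(2) by blast
qed auto

lemma lc_strict:
  assumes "has_nil_index L br s" "1 \<le> k" "k \<le> s"
  shows "lc (Suc k) \<subset> lc k"
proof -
  have "\<not> lc k \<subseteq> lc (Suc k)"
  proof
    assume "lc k \<subseteq> lc (Suc k)"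
    then have "lc k \<subseteq> lc (s + 1)"
      using lc_stationary[of k "s + 1"] assms(2,3) by simp
    then have "lc s \<subseteq> {0}" using lc_antimono[OF assms(3)] assms(1) by (auto simp: has_nil_index_def)
    then show False using assms(1) zero_mem_lc[of s] by (auto simp: has_nil_index_def)
  qed
  then show ?thesis using lc_Suc_subset[of k] by blast
qed

lemma has_nil_index_le:
  assumes "has_nil_index L br s" "has_nil_index L br t"
  shows "s \<le> t"
proof (rule ccontr)
  assume "\<not> s \<le> t"
  then have "lc s \<subseteq> lc (t + 1)" by (intro lc_antimono) auto
  then show False using assms zero_mem_lc[of s] by (auto simp: has_nil_index_def)
qed

lemma nil_index_eq: "has_nil_index L br s \<Longrightarrow> nil_index L br = s"
  unfolding nil_index_def by (rule the_equality) (auto intro: antisym has_nil_index_le)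

lemma dim_lc_less:
  assumes "has_nil_index L br s" "dim L > 0" "1 \<le> k" "k \<le> s"
  shows "dim (lc (Suc k)) < dim (lc k)"
proof -
  obtain F where "finite F" "L \<subseteq> span F" using finite_span_if_dim_pos[OF assms(2)] .
  with lc_strict[OF assms(1,3,4)] lc_subset[of k] show ?thesis
    by (intro dim_psubset_finite_span subspace_lc) auto
qed

text \<open>Each step down the series costs at least one dimension; \<open>j = Suc s\<close> is
  allowed because the final drop to zero counts too.\<close>

lemma dim_lc_diff:
  assumes "has_nil_index L br s" "dim L > 0" "1 \<le> i" "i \<le> j" "j \<le> Suc s"
  shows "dim (lc j) + (j - i) \<le> dim (lc i)"
  using assms(4,5)
proof (induction rule: dec_induct)
  case (step j)
  then show ?case using dim_lc_less[OF assms(1,2), of j] assms(3) by simp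
qed auto

lemma nil_index_le_dim:
  assumes "has_nil_index L br s" "dim L > 0"
  shows "s \<le> dim L"
  using dim_lc_diff[OF assms, of 1 "Suc s"] by simp

text \<open>If \<open>L = \<real>y + [L,L]\<close>, then \<open>[L,L] \<subseteq> [L,[L,L]]\<close> because \<open>[y,y] = 0\<close>.\<close>
lemma two_generators:
  assumes s: "has_nil_index L br s" "s \<ge> 2" and y: "y \<in> L"
  shows "\<not> L \<subseteq> span (insert y (lc 2))"
proof
  assume sub: "L \<subseteq> span (insert y (lc 2))"
  have "br u v \<in> lc 3" if uv: "u \<in> L" "v \<in> L" for u v
  proof -
    obtain c u' where u: "u' \<in> lc 2" "u = c *\<^sub>R y + u'"
      using mem_span_insert_subspace[OF subspace_lc] sub uv by blast
    obtain d v' where v: "v' \<in> lc 2" "v = d *\<^sub>R y + v'"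
      using mem_span_insert_subspace[OF subspace_lc] sub uv by blast
    have L: "u' \<in> L" "v' \<in> L" using u v lc_mem by blast+
    have "br u v = c *\<^sub>R br y v' - d *\<^sub>R br y u' + br u' v'"
      using y L unfolding u(2) v(2)
      by (simp add: bracket_add_left bracket_add_right bracket_scaleR_left bracket_scaleR_right
          bracket_self carrier_closed bracket_antisym[of u' y])
    moreover have "br y v' \<in> lc 3" "br y u' \<in> lc 3" "br u' v' \<in> lc 3"
      using bracket_lc[of 2] y L u(1) v(1) by auto
    ultimately show ?thesis by (simp add: lc_closed)
  qed
  then have "lc (Suc 1) \<subseteq> lc (Suc 2)"
    by (intro lc_Suc_le subspace_lc) auto
  then show False using lc_strict[OF s(1), of 2] s(2) by (simp add: numeral_2_eq_2)
qed

text \<open>The span of \<open>lc 2\<close> and one vector outside it lies strictly between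
  \<open>lc 2\<close> and \<open>L\<close>, since one generator modulo \<open>lc 2\<close> never
  suffices.\<close>

lemma dim_lc2_le:
  assumes s: "has_nil_index L br s" "s \<ge> 2" and "dim L > 0"
  shows "dim (lc 2) + 2 \<le> dim L"
proof -
  obtain F where F: "finite F" "L \<subseteq> span F" using finite_span_if_dim_pos[OF assms(3)] .
  have "lc 2 \<subset> L" using lc_strict[OF s(1), of 1] s(2) by (simp add: numeral_2_eq_2)
  then obtain y where y: "y \<in> L" "y \<notin> lc 2" by blast
  define V where "V = span (insert y (lc 2))"
  have VL: "V \<subseteq> L"
    unfolding V_def using y lc_subset[of 2] by (intro span_minimal subspace_carrier) auto
  have "lc 2 \<subset> V" unfolding V_def using y(2) by (rule span_insert_psubset)
  then have "dim (lc 2) < dim V"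
    using VL F by (intro dim_psubset_finite_span subspace_lc) auto
  moreover have "V \<subset> L"
    using VL two_generators[OF s y(1)] by (auto simp: V_def)
  then have "dim V < dim L"
    using F by (intro dim_psubset_finite_span) (auto simp: V_def)
  ultimately show ?thesis by simp
qed

text \<open>Otherwise adjoining \<open>y\<close> gives a subspace strictly between the two terms.
  Together with the drops elsewhere and the codimension of \<open>lc 2\<close>, this makes
  \<open>dim L\<close> at least \<open>s + 2\<close>.\<close>

lemma filiform_step:
  assumes s: "has_nil_index L br s" "s \<ge> 2" and dim: "dim L = s + 1"
    and k: "2 \<le> k" "k \<le> s" and y: "y \<in> lc k" "y \<notin> lc (Suc k)"
  shows "lc k \<subseteq> span (insert y (lc (Suc k)))"
proof (rule ccontr)
  assume not: "\<not> ?thesis"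
  obtain F where F: "finite F" "L \<subseteq> span F"
    using finite_span_if_dim_pos[of L] dim by auto
  define V where "V = span (insert y (lc (Suc k)))"
  have V: "V \<subseteq> lc k"
    unfolding V_def using y lc_Suc_subset[of k] by (intro span_minimal subspace_lc) auto
  have "lc (Suc k) \<subset> V" unfolding V_def using y(2) by (rule span_insert_psubset)
  then have "dim (lc (Suc k)) < dim V"
    using V lc_subset[of k] F by (intro dim_psubset_finite_span subspace_lc) auto
  moreover have "V \<subset> lc k" using V not by (auto simp: V_def)
  then have "dim V < dim (lc k)"
    using lc_subset[of k] F by (intro dim_psubset_finite_span) (auto simp: V_def)
  moreover have "dim (lc (s + 1)) + (s + 1 - Suc k) \<le> dim (lc (Suc k))"
    using s dim k by (intro dim_lc_diff) auto
  moreover have "dim (lc k) + (k - 2) \<le> dim (lc 2)"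
    using s dim k by (intro dim_lc_diff) auto
  moreover have "dim (lc 2) + 2 \<le> dim L" using s dim by (intro dim_lc2_le) auto
  ultimately show False using k dim by simp
qed

text \<open>The \<open>s - 1\<close> drops below \<open>lc 2\<close> leave at most two dimensions
  above it: \<open>y\<close> takes one and \<open>x\<close> the other.\<close>

lemma filiform_generators:
  assumes s: "has_nil_index L br s" "s \<ge> 2" and dim: "dim L = s + 1"
    and y: "y \<in> L" "y \<notin> lc 2"
  obtains x where "x \<in> L" "L \<subseteq> span (insert x (span (insert y (lc 2))))"
proof -
  obtain F where F: "finite F" "L \<subseteq> span F"
    using finite_span_if_dim_pos[of L] dim by auto
  define V where "V = span (insert y (lc 2))"
  have V: "V \<subseteq> L"
    unfolding V_def using y lc_subset[of 2] by (intro span_minimal subspace_carrier) auto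
  have "lc 2 \<subset> V" unfolding V_def using y(2) by (rule span_insert_psubset)
  then have 1: "dim (lc 2) < dim V"
    using V F by (intro dim_psubset_finite_span subspace_lc) auto
  obtain x where x: "x \<in> L" "x \<notin> V"
    using two_generators[OF s y(1)] by (auto simp: V_def)
  define W where "W = span (insert x V)"
  have W: "W \<subseteq> L"
    unfolding W_def using x V by (intro span_minimal subspace_carrier) auto
  have "V \<subset> W" unfolding W_def using x(2) by (rule span_insert_psubset)
  then have 2: "dim V < dim W"
    using W F by (intro dim_psubset_finite_span) (auto simp: V_def)
  have 3: "dim (lc (s + 1)) + (s + 1 - 2) \<le> dim (lc 2)"
    using s dim by (intro dim_lc_diff) auto
  have "\<not> W \<subset> L"
  proof
    assume "W \<subset> L"
    then have "dim W < dim L"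
      using F by (intro dim_psubset_finite_span) (auto simp: W_def)
    then show False using 1 2 3 dim s by simp
  qed
  then show ?thesis using that[OF x(1)] W by (auto simp: W_def V_def)
qed

section \<open>Complex structures and filiform algebras\<close>

lemma no_complex_structure_filiform:
  assumes s: "has_nil_index L br s" "s \<ge> 2" and dim: "dim L = s + 1"
  shows "\<not> complex_structure L br J"
proof
  assume "complex_structure L br J"
  then interpret J: complex_structure L br J .
  have J_neg: "J (- x) = - J x" if "x \<in> L" for x
    using J.scaleR[OF that, of "-1"] by simp
  \<comment> \<open>\<open>W k\<close> is the largest \<open>J\<close>-stable subspace of
    \<open>lc k\<close>.\<close>
  define W where "W k = {y \<in> lc k. J y \<in> lc k}" for k
  have W_J: "J y \<in> W k" if "y \<in> W k" for y k
    using that J.square lc_mem by (auto simp: W_def lc_closed)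
  \<comment> \<open>\<open>x - \<i>Jx\<close> and \<open>y - \<i>Jy\<close> have the bracket \<open>u - \<i>Ju\<close> with \<open>u = [x,y] - [Jx,Jy]\<close>.\<close>
  have W_step: "br x y - br (J x) (J y) \<in> W (Suc k)" if "k \<ge> 1" "x \<in> L" "y \<in> W k" for x y k
  proof -
    have y: "y \<in> lc k" "J y \<in> lc k" "y \<in> L" using that lc_mem by (auto simp: W_def)
    have mem: "br (J x) y \<in> L" "br x (J y) \<in> L"
      using that(2) y J.closed bracket_closed by auto
    have "br x y - br (J x) (J y) = - J (br (J x) y + br x (J y))"
      using J.integrable[OF that(2) y(3)] J.add[OF mem] by simp
    then have "J (br x y - br (J x) (J y)) = br (J x) y + br x (J y)"
      using mem by (simp add: J_neg J.closed J.square carrier_closed)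
    moreover have "br (J x) y + br x (J y) \<in> lc (Suc k)" "br x y - br (J x) (J y) \<in> lc (Suc k)"
      using that y by (auto intro!: lc_closed bracket_lc J.closed)
    ultimately show ?thesis by (simp add: W_def)
  qed
  define k where "k = (GREATEST k. W k \<noteq> {0})"
  have W0: "W j = {0}" if "s < j" for j
  proof -
    have "lc j \<subseteq> {0}"
      using lc_antimono[of "s + 1" j] that s(1) by (auto simp: has_nil_index_def)
    moreover have "J 0 = 0" using J.scaleR[of 0 0] carrier_closed by simp
    ultimately show ?thesis using zero_mem_lc[of j] by (auto simp: W_def)
  qed
  have W1: "W 1 \<noteq> {0}"
  proof -
    obtain z where "z \<in> L" "z \<noteq> 0"
      using s(1) zero_mem_lc[of s] lc_mem[of _ s] by (auto simp: has_nil_index_def)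
    then have "z \<in> W 1" using J.closed by (simp add: W_def)
    then show ?thesis using \<open>z \<noteq> 0\<close> by blast
  qed
  have bound: "\<forall>j. W j \<noteq> {0} \<longrightarrow> j \<le> s" using W0 by (meson not_le)
  have "W k \<noteq> {0}" unfolding k_def using GreatestI_nat[of "\<lambda>j. W j \<noteq> {0}"] W1 bound by blast
  have "k \<le> s" using bound \<open>W k \<noteq> {0}\<close> by blast
  have "k \<ge> 1" unfolding k_def using Greatest_le_nat[of "\<lambda>j. W j \<noteq> {0}"] W1 bound by blast
  have Wk: "W (Suc k) = {0}"
  proof (rule ccontr)
    assume "W (Suc k) \<noteq> {0}"
    then have "Suc k \<le> k" using Greatest_le_nat[of "\<lambda>j. W j \<noteq> {0}"] bound unfolding k_def by blast
    then show False by simp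
  qed
  \<comment> \<open>The identity of abelian complex structures, with one argument restricted to
    \<open>W k\<close>: the difference of both sides lies in \<open>W (Suc k)\<close>.\<close>
  have abelian: "br (J x) (J y) = br x y" if "x \<in> L" "y \<in> W k" for x y
    using W_step[OF \<open>k \<ge> 1\<close> that] Wk by simp
  show False
  proof (cases "k = 1")
    case True
    have "W 2 = {0}" using Wk True by (simp add: numeral_2_eq_2)
    obtain z where z: "z \<in> lc s" "z \<noteq> 0"
      using s(1) zero_mem_lc[of s] by (auto simp: has_nil_index_def)
    have zL: "z \<in> L" "J z \<in> L" using z(1) lc_mem J.closed by auto
    have "z \<in> lc 2" using z(1) lc_antimono[of 2 s] s(2) by blast
    then have Jz: "J z \<notin> lc 2" using z(2) \<open>W 2 = {0}\<close> unfolding W_def by blast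
    have z_central: "br x z = 0" if "x \<in> L" for x
      using bracket_lc[of s x z] that z(1) s by (simp add: has_nil_index_def)
    \<comment> \<open>Write \<open>x = J (- J x)\<close> and drop \<open>J\<close> from both
      arguments; \<open>z\<close> is central because it lies in the last nonzero term.\<close>
    have Jz_central: "br x (J z) = 0" if "x \<in> L" for x
    proof -
      have "z \<in> W k" using True zL by (simp add: W_def)
      have "br (J (- J x)) (J z) = br (- J x) z"
        using that \<open>z \<in> W k\<close> by (intro abelian) (auto intro: carrier_closed J.closed)
      then show ?thesis
        using z_central[of "- J x"] that by (simp add: J_neg J.closed J.square carrier_closed)
    qed
    have Jz_central': "br (J z) x = 0" if "x \<in> L" for x
      using Jz_central[OF that] bracket_antisym[OF zL(2) that] by simp
    obtain x where x: "x \<in> L" "L \<subseteq> span (insert x (span (insert (J z) (lc 2))))"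
      using filiform_generators[OF s dim zL(2) Jz] .
    \<comment> \<open>Modulo \<open>lc 2\<close> and the central \<open>J z\<close> only multiples
      of \<open>x\<close> remain, and \<open>br x x = 0\<close>; every surviving term has an
      argument in \<open>lc 2\<close>.\<close>
    have "br u v \<in> lc 3" if "u \<in> L" "v \<in> L" for u v
    proof -
      have split: "\<exists>a b w. w \<in> lc 2 \<and> t = a *\<^sub>R x + (b *\<^sub>R J z + w)" if t: "t \<in> L" for t
      proof -
        obtain a t' where "t' \<in> span (insert (J z) (lc 2))" "t = a *\<^sub>R x + t'"
          by (rule mem_span_insert_subspace[OF subspace_span subsetD[OF x(2) t]])
        then show ?thesis using mem_span_insert_subspace[OF subspace_lc] by metis
      qed
      obtain a b u' where u: "u' \<in> lc 2" "u = a *\<^sub>R x + (b *\<^sub>R J z + u')"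
        using split \<open>u \<in> L\<close> by blast
      obtain c d v' where v: "v' \<in> lc 2" "v = c *\<^sub>R x + (d *\<^sub>R J z + v')"
        using split \<open>v \<in> L\<close> by blast
      have L: "u' \<in> L" "v' \<in> L" using u v lc_mem by blast+
      have "br u v = a *\<^sub>R br x v' - c *\<^sub>R br x u' + br u' v'"
        using x(1) zL L unfolding u(2) v(2)
        by (simp add: bracket_add_left bracket_add_right bracket_scaleR_left bracket_scaleR_right
            bracket_self carrier_closed bracket_antisym[of u' x] Jz_central Jz_central')
      moreover have "br x v' \<in> lc 3" "br x u' \<in> lc 3" "br u' v' \<in> lc 3"
        using bracket_lc[of 2] x(1) L u(1) v(1) by auto
      ultimately show ?thesis by (simp add: lc_closed)
    qed
    then have "lc (Suc 1) \<subseteq> lc (Suc 2)"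
      by (intro lc_Suc_le subspace_lc) auto
    then show False using lc_strict[OF s(1), of 2] s(2) by (simp add: numeral_2_eq_2)
  next
    case False
    then have "k \<ge> 2" using \<open>k \<ge> 1\<close> by simp
    obtain y0 where y0: "y0 \<in> W k" "y0 \<noteq> 0"
      using \<open>W k \<noteq> {0}\<close> W0 \<open>k \<le> s\<close> zero_mem_lc[of k] J.scaleR[of 0 0] carrier_closed(4)
      by (auto simp: W_def)
    \<comment> \<open>Whichever of \<open>y0\<close> and \<open>J y0\<close> lies outside
      \<open>lc (Suc k)\<close> serves as \<open>y\<close>.\<close>
    have "y0 \<notin> lc (Suc k) \<or> J y0 \<notin> lc (Suc k)" using y0 Wk unfolding W_def by blast
    then obtain y where y: "y \<in> W k" "y \<notin> lc (Suc k)" using y0 W_J by blast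
    have yk: "y \<in> lc k" "J y \<in> lc k" "y \<in> L" using y(1) lc_mem by (auto simp: W_def)
    have span: "lc k \<subseteq> span (insert y (lc (Suc k)))"
      using filiform_step[OF s dim \<open>k \<ge> 2\<close> \<open>k \<le> s\<close> yk(1) y(2)] .
    obtain q r where q: "r \<in> lc (Suc k)" "J y = q *\<^sub>R y + r"
      using mem_span_insert_subspace[OF subspace_lc] span yk(2) by blast
    have "r \<in> L" using q(1) lc_mem by blast
    have cong: "br x (J y) - q *\<^sub>R br x y \<in> lc (Suc (Suc k))" if "x \<in> L" for x
      using bracket_lc[of "Suc k" x r] that q(1) \<open>r \<in> L\<close> yk(3)
      by (simp add: q(2) bracket_add_right bracket_scaleR_right carrier_closed)
    have y_br: "br x y \<in> lc (Suc (Suc k))" if x: "x \<in> L" for x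
    proof -
      have "br (J (J x)) (J y) = br (J x) y" using x y(1) by (intro abelian J.closed)
      then have "br (J x) y = - br x (J y)"
        using x yk J.closed bracket_scaleR_left[of x "J y" "-1"] by (simp add: J.square)
      \<comment> \<open>The congruence at \<open>J x\<close> minus \<open>q\<close> times the one at
        \<open>x\<close>: by \<open>[Jx,Jy] = [x,y]\<close> and \<open>[Jx,y] = -[x,Jy]\<close> the
        mixed terms cancel.\<close>
      then have "(br (J x) (J y) - q *\<^sub>R br (J x) y) - q *\<^sub>R (br x (J y) - q *\<^sub>R br x y)
          = (1 + q * q) *\<^sub>R br x y"
        using abelian[OF x y(1)] by (simp add: algebra_simps)
      moreover have "(br (J x) (J y) - q *\<^sub>R br (J x) y) - q *\<^sub>R (br x (J y) - q *\<^sub>R br x y)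
          \<in> lc (Suc (Suc k))"
        by (rule lc_closed(2)[OF cong[OF J.closed[OF x]] lc_closed(3)[OF cong[OF x]]])
      ultimately have mem: "(1 + q * q) *\<^sub>R br x y \<in> lc (Suc (Suc k))" by (simp only:)
      have "1 + q * q \<noteq> 0" using zero_le_square[of q] by linarith
      then have "br x y = (1 / (1 + q * q)) *\<^sub>R ((1 + q * q) *\<^sub>R br x y)" by simp
      then show ?thesis using lc_closed(3)[OF mem] by metis
    qed
    show False
    proof (cases "k = s")
      case True
      \<comment> \<open>Here \<open>lc (Suc k)\<close> is zero, so \<open>q\<close> would be a real
        eigenvalue of \<open>J\<close>.\<close>
      have "r = 0" using q(1) True s(1) by (simp add: has_nil_index_def)
      then have "- y = (q * q) *\<^sub>R y"
        using J.square[OF yk(3)] J.scaleR[OF yk(3), of q] q(2) by simp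
      then have "(1 + q * q) *\<^sub>R y = 0"
        by (metis add.right_inverse scaleR_add_left scaleR_one)
      moreover have "1 + q * q \<noteq> 0" using zero_le_square[of q] by linarith
      ultimately have "y = 0" by simp
      then show False using y(2) zero_mem_lc by blast
    next
      case False
      have "lc (Suc k) \<subseteq> lc (Suc (Suc k))"
      proof (rule lc_Suc_le[OF \<open>k \<ge> 1\<close> subspace_lc])
        fix x v assume x: "x \<in> L" and "v \<in> lc k"
        then obtain c w where v: "w \<in> lc (Suc k)" "v = c *\<^sub>R y + w"
          using mem_span_insert_subspace[OF subspace_lc] span by blast
        have "w \<in> L" using v lc_mem by blast
        then have "br x v = c *\<^sub>R br x y + br x w"
          using x yk(3) by (simp add: v(2) bracket_add_right bracket_scaleR_right carrier_closed)
        then show "br x v \<in> lc (Suc (Suc k))"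
          using lc_closed(1)[OF lc_closed(3)[OF y_br[OF x]] bracket_lc[OF _ x v(1)]] by simp
      qed
      then show False using lc_strict[OF s(1), of "Suc k"] False \<open>k \<le> s\<close> by simp
    qed
  qed
qed

text \<open>In dimension 2 the abelian plane has nil-index 1, so the bound starts at dimension 4.
  From there on a failure forces \<open>dim L = s + 1\<close>, the case just excluded.\<close>

lemma nil_index_le_dim_minus_2:
  assumes "has_nil_index L br s" "dim L \<ge> 4" "complex_structure L br J"
  shows "s + 2 \<le> dim L"
proof (rule ccontr)
  assume not: "\<not> ?thesis"
  then have "s \<ge> 2" using assms(2) by simp
  have "dim (lc (s + 1)) + (s + 1 - 2) \<le> dim (lc 2)"
    using assms \<open>s \<ge> 2\<close> by (intro dim_lc_diff) auto
  moreover have "dim (lc 2) + 2 \<le> dim L"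
    using assms \<open>s \<ge> 2\<close> by (intro dim_lc2_le) auto
  ultimately have "dim L = s + 1" using not \<open>s \<ge> 2\<close> by simp
  then show False using no_complex_structure_filiform assms \<open>s \<ge> 2\<close> by blast
qed

end

subsection \<open>Truncated loop algebras\<close>

lemma Times_subset_span:
  fixes V :: "'a::real_vector set" and W :: "'b::real_vector set"
  assumes "V \<subseteq> span A" "W \<subseteq> span B"
  shows "V \<times> W \<subseteq> span (A \<times> {0} \<union> {0} \<times> B)"
proof safe
  fix x y assume "x \<in> V" "y \<in> W"
  then have xy: "x \<in> span A" "y \<in> span B" using assms by auto
  have lin: "linear (\<lambda>x. (x::'a, 0::'b))" "linear (\<lambda>y. (0::'a, y::'b))"
    by (auto intro!: linearI)
  have "(x, 0) \<in> span ((\<lambda>x. (x, 0::'b)) ` A)" "(0, y) \<in> span ((\<lambda>y. (0::'a, y)) ` B)"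
    using xy by (simp_all add: linear_span_image[OF lin(1)] linear_span_image[OF lin(2)])
  moreover have "(\<lambda>x. (x, 0)) ` A \<subseteq> A \<times> {0} \<union> {0} \<times> B"
    "(\<lambda>y. (0, y)) ` B \<subseteq> A \<times> {0} \<union> {0} \<times> B" by auto
  ultimately have "(x, 0) + (0, y) \<in> span (A \<times> {0} \<union> {0} \<times> B)"
    by (meson span_add span_mono subsetD)
  then show "(x, y) \<in> span (A \<times> {0} \<union> {0} \<times> B)" by simp
qed

text \<open>Bases of the two factors, embedded with zero in the other coordinate, together form a
  basis of the product.\<close>

lemma dim_Times_finite_span:
  fixes V :: "'a::real_vector set" and W :: "'b::real_vector set"
  assumes V: "subspace V" "finite F" "V \<subseteq> span F" and W: "subspace W" "finite G" "W \<subseteq> span G"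
  shows "dim (V \<times> W) = dim V + dim W"
proof -
  obtain A where A: "A \<subseteq> V" "independent A" "V \<subseteq> span A" "card A = dim V"
    using basis_exists by blast
  obtain B where B: "B \<subseteq> W" "independent B" "W \<subseteq> span B" "card B = dim W"
    using basis_exists by blast
  have fin: "finite A" "finite B"
    using independent_span_bound[OF V(2) A(2) order.trans[OF A(1) V(3)]]
      independent_span_bound[OF W(2) B(2) order.trans[OF B(1) W(3)]] by auto
  define C where "C = A \<times> {0::'b} \<union> {0::'a} \<times> B"
  \<comment> \<open>Deleting a vector from \<open>C\<close> deletes it from one factor only, so
    independence can be tested in that factor.\<close>
  have le: "span C' \<subseteq> span A' \<times> span B'"
    if "C' \<subseteq> A' \<times> {0} \<union> {0} \<times> B'" for C' and A' :: "'a set" and B' :: "'b set"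
    using that by (intro span_minimal subspace_Times) (auto intro: span_base span_zero)
  have indep: "independent C"
    unfolding dependent_def
  proof (rule notI, elim bexE)
    fix c assume c: "c \<in> C" "c \<in> span (C - {c})"
    from c(1) consider a where "c = (a, 0)" "a \<in> A" | b where "c = (0, b)" "b \<in> B"
      by (auto simp: C_def)
    then show False
    proof cases
      case 1
      then have "c \<in> span (A - {a}) \<times> span B"
        using c(2) le[of "C - {c}" "A - {a}" B] by (auto simp: C_def)
      then show False using 1 A(2) by (auto simp: dependent_def)
    next
      case 2
      then have "c \<in> span A \<times> span (B - {b})"
        using c(2) le[of "C - {c}" A "B - {b}"] by (auto simp: C_def)
      then show False using 2 B(2) by (auto simp: dependent_def)
    qed
  qed
  have "V \<times> W \<subseteq> span C" unfolding C_def using A(3) B(3) by (rule Times_subset_span)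
  moreover have "C \<subseteq> V \<times> W"
    using A(1) B(1) subspace_0[OF V(1)] subspace_0[OF W(1)] by (auto simp: C_def)
  ultimately have "dim (V \<times> W) = card C" using indep by (intro dim_unique) auto
  also have "\<dots> = card (A \<times> {0::'b}) + card ({0::'a} \<times> B)"
    unfolding C_def
  proof (rule card_Un_disjoint)
    show "(A \<times> {0}) \<inter> ({0} \<times> B) = {}" using A(2) dependent_zero by blast
  qed (use fin in auto)
  finally show ?thesis using A(4) B(4) by (simp add: card_cartesian_product)
qed

section \<open>Real polynomials: support and truncation\<close>

type_synonym rpoly = "nat \<Rightarrow>\<^sub>0 real"

lemma lookup_scaleR: "Poly_Mapping.lookup (c *\<^sub>R p) k = c *\<^sub>R Poly_Mapping.lookup p k"
  for p :: "'a \<Rightarrow>\<^sub>0 'b::real_vector"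
proof -
  have "finite {i. c *\<^sub>R Poly_Mapping.lookup p i \<noteq> 0}"
    by (rule finite_subset[OF _ finite_keys[of p]]) (auto simp: in_keys_iff)
  then show ?thesis by (simp add: scaleR_poly_mapping_def)
qed

text \<open>Lets the bilinearity of multiplication follow from the ring laws.\<close>

lemma scaleR_eq_mult: "c *\<^sub>R p = Poly_Mapping.single 0 c * p" for p :: rpoly
proof (rule poly_mapping_eqI)
  fix k
  have "Poly_Mapping.lookup (Poly_Mapping.map ((*) c) p) k = c * Poly_Mapping.lookup p k"
    by (simp add: Poly_Mapping.map.rep_eq when_def)
  then show "Poly_Mapping.lookup (c *\<^sub>R p) k = Poly_Mapping.lookup (Poly_Mapping.single 0 c * p) k"
    by (simp add: lookup_scaleR mult_map_scale_conv_mult)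
qed

lemma mult_scaleR_left_rpoly: "(c *\<^sub>R p) * q = c *\<^sub>R (p * q)" for p q :: rpoly
  by (simp only: scaleR_eq_mult mult.assoc)

lemma mult_scaleR_right_rpoly: "p * (c *\<^sub>R q) = c *\<^sub>R (p * q)" for p q :: rpoly
  by (simp only: scaleR_eq_mult mult.left_commute[of p])

definition supported :: "nat set \<Rightarrow> rpoly set" where
  "supported I = {p. Poly_Mapping.keys p \<subseteq> I}"

lemma supported_iff: "p \<in> supported I \<longleftrightarrow> (\<forall>k. k \<notin> I \<longrightarrow> Poly_Mapping.lookup p k = 0)"
  by (auto simp: supported_def in_keys_iff)

lemma subspace_supported: "subspace (supported I)"
  by (auto simp: subspace_def supported_iff lookup_add lookup_scaleR)

lemma supported_eq_span: "supported I = span ((\<lambda>k. Poly_Mapping.single k 1) ` I)"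
proof
  show "span ((\<lambda>k. Poly_Mapping.single k 1) ` I) \<subseteq> supported I"
    by (intro span_minimal subspace_supported) (auto simp: supported_def)
  show "supported I \<subseteq> span ((\<lambda>k. Poly_Mapping.single k 1) ` I)"
  proof
    fix p assume p: "p \<in> supported I"
    have "p = (\<Sum>k\<in>Poly_Mapping.keys p. Poly_Mapping.lookup p k *\<^sub>R Poly_Mapping.single k 1)"
      by (rule poly_mapping_eqI)
        (simp add: lookup_sum lookup_scaleR lookup_single when_def in_keys_iff mult_delta_right)
    also have "\<dots> \<in> span ((\<lambda>k. Poly_Mapping.single k 1) ` I)"
      using p by (intro span_sum span_scale span_base) (auto simp: supported_def)
    finally show "p \<in> span ((\<lambda>k. Poly_Mapping.single k 1) ` I)" .
  qed
qed

lemma dim_supported: "finite I \<Longrightarrow> dim (supported I) = card I"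
proof -
  have inj: "inj_on (\<lambda>k. Poly_Mapping.single k (1::real)) I"
    by (rule inj_onI) (metis keys_single singleton_inject zero_neq_one)
  have "independent ((\<lambda>k. Poly_Mapping.single k (1::real)) ` I)"
    by (rule independent_mono[OF independent_single]) auto
  then show ?thesis
    unfolding supported_eq_span dim_span by (simp add: dim_eq_card_independent card_image[OF inj])
qed

lemma supported_mult:
  assumes "p \<in> supported I" "q \<in> supported K" "\<And>i k. i \<in> I \<Longrightarrow> k \<in> K \<Longrightarrow> i + k \<in> M"
  shows "p * q \<in> supported M"
  using assms keys_mult[of p q] by (fastforce simp: supported_def)

text \<open>The representative of \<open>p\<close> modulo \<open>t^(s+1)\<close>: the quotient ring
  is modelled on polynomials of degree at most \<open>s\<close>.\<close>

definition trunc :: "nat \<Rightarrow> rpoly \<Rightarrow> rpoly" where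
  "trunc s p = Poly_Mapping.mapp (\<lambda>k c. c when k \<le> s) p"

lemma lookup_trunc: "Poly_Mapping.lookup (trunc s p) k = (Poly_Mapping.lookup p k when k \<le> s)"
  by (simp add: trunc_def lookup_mapp when_def in_keys_iff)

lemma trunc_add: "trunc s (p + q) = trunc s p + trunc s q"
  and trunc_diff: "trunc s (p - q) = trunc s p - trunc s q"
  and trunc_uminus: "trunc s (- p) = - trunc s p"
  and trunc_scaleR: "trunc s (c *\<^sub>R p) = c *\<^sub>R trunc s p"
  by (rule poly_mapping_eqI, simp add: lookup_trunc lookup_add lookup_minus lookup_scaleR when_def)+

lemma trunc_zero: "trunc s 0 = 0"
  by (rule poly_mapping_eqI) (simp add: lookup_trunc)

lemma trunc_supported: "p \<in> supported I \<Longrightarrow> trunc s p \<in> supported (I \<inter> {..s})"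
  by (auto simp: supported_iff lookup_trunc when_def)

lemma trunc_single: "k \<le> s \<Longrightarrow> trunc s (Poly_Mapping.single k c) = Poly_Mapping.single k c"
  by (rule poly_mapping_eqI) (auto simp: lookup_trunc lookup_single when_def)

text \<open>\<open>q - trunc s q\<close> lies in the ideal generated by \<open>t^(s+1)\<close>,
  hence so does its product with \<open>p\<close>, and \<open>trunc s\<close> vanishes
  there.\<close>

lemma trunc_mult_trunc: "trunc s (p * trunc s q) = trunc s (p * q)"
proof -
  have "p * (q - trunc s q) \<in> supported {s<..}"
    by (rule supported_mult[of _ UNIV _ "{s<..}"])
      (auto simp: supported_iff lookup_trunc lookup_minus when_def)
  then have "trunc s (p * (q - trunc s q)) = 0"
    by (intro poly_mapping_eqI) (auto simp: lookup_trunc supported_iff when_def)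
  then show ?thesis by (simp add: algebra_simps trunc_diff)
qed

text \<open>
  A triple \<open>(a, b, c)\<close> of polynomials in \<open>t\<close> stands for \<open>a u + b v + c w\<close> in \<open>so(3) \<otimes> \<real>[t]/(t\<^bsup>s+1\<^esup>)\<close>,
  where \<open>[u,v] = w\<close>, \<open>[v,w] = u\<close>, \<open>[w,u] = v\<close>.
\<close>
fun loop_bracket :: "nat \<Rightarrow> rpoly \<times> rpoly \<times> rpoly \<Rightarrow> rpoly \<times> rpoly \<times> rpoly \<Rightarrow> rpoly \<times> rpoly \<times> rpoly" where
  "loop_bracket s (a, b, c) (a', b', c') =
    (trunc s (b * c' - c * b'), trunc s (c * a' - a * c'), trunc s (a * b' - b * a'))"

definition odds :: "nat \<Rightarrow> nat set" where
  "odds s = {k. odd k \<and> k \<le> s}"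

definition evens :: "nat \<Rightarrow> nat set" where
  "evens q = {k. even k \<and> 0 < k \<and> k \<le> 2 * q}"

text \<open>
  \<open>q\<close> may exceed \<open>s div 2\<close>: the monomials of degree above \<open>s\<close> in the third component are then
  central, and serve to make its dimension \<open>q\<close> even.
\<close>
definition loop_algebra :: "nat \<Rightarrow> nat \<Rightarrow> (rpoly \<times> rpoly \<times> rpoly) set" where
  "loop_algebra s q = supported (odds s) \<times> supported (odds s) \<times> supported (evens q)"

lemma card_odds: "finite (odds s)" "card (odds s) = (s + 1) div 2"
proof -
  have "odds s = (\<lambda>i. 2 * i + 1) ` {..<(s + 1) div 2}"
    by (auto simp: odds_def image_iff elim!: oddE)
  then show "finite (odds s)" "card (odds s) = (s + 1) div 2"
    by (auto simp: card_image inj_on_def)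
qed

lemma card_evens: "finite (evens q)" "card (evens q) = q"
proof -
  have "evens q = (\<lambda>i. 2 * i) ` {1..q}"
    by (auto simp: evens_def image_iff elim!: evenE)
  then show "finite (evens q)" "card (evens q) = q"
    by (auto simp: card_image inj_on_def)
qed

lemma subspace_loop_algebra: "subspace (loop_algebra s q)"
  unfolding loop_algebra_def by (intro subspace_Times subspace_supported)

lemma dim_loop_algebra: "dim (loop_algebra s q) = 2 * ((s + 1) div 2) + q"
proof -
  let ?S = "\<lambda>I. (\<lambda>k. Poly_Mapping.single k (1::real)) ` I"
  have fin: "finite (?S (odds s))" "finite (?S (evens q))"
    using card_odds(1) card_evens(1) by auto
  have sub: "supported I \<subseteq> span (?S I)" for I
    by (simp add: supported_eq_span)
  have "dim (supported (odds s) \<times> supported (evens q)) = (s + 1) div 2 + q"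
    by (subst dim_Times_finite_span[OF subspace_supported fin(1) sub subspace_supported fin(2) sub])
      (simp add: dim_supported card_odds card_evens)
  then show ?thesis
    unfolding loop_algebra_def
    by (subst dim_Times_finite_span[OF subspace_supported fin(1) sub
          subspace_Times[OF subspace_supported subspace_supported] _ Times_subset_span[OF sub sub]])
      (use fin in \<open>simp_all add: dim_supported card_odds\<close>)
qed

lemma trunc_diff_mult_trunc:
  "trunc s (p * trunc s q - p' * trunc s q') = trunc s (p * q - p' * q')"
  by (simp only: trunc_diff trunc_mult_trunc)

text \<open>First component of the Jacobi identity for the cross product; cyclic permutation of the
  letters gives the other two.\<close>

lemma cross_jacobi_component:
  fixes a b c :: "'a::comm_ring_1"
  shows "b * (a' * b'' - b' * a'') - c * (c' * a'' - a' * c'')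
    + (b' * (a'' * b - b'' * a) - c' * (c'' * a - a'' * c))
    + (b'' * (a * b' - b * a') - c'' * (c * a' - a * c')) = 0"
  by (simp add: algebra_simps)

text \<open>The outer truncation absorbs the inner one, which leaves the identity for the cross
  product.\<close>

lemma loop_bracket_jacobi:
  "loop_bracket s x (loop_bracket s y z) + loop_bracket s y (loop_bracket s z x)
    + loop_bracket s z (loop_bracket s x y) = 0"
proof (cases x; cases y; cases z)
  fix a b c a' b' c' a'' b'' c'' :: rpoly
  assume "x = (a, b, c)" "y = (a', b', c')" "z = (a'', b'', c'')"
  then show ?thesis
    by (simp only: loop_bracket.simps trunc_diff_mult_trunc add_Pair trunc_add[symmetric]
        zero_prod_def cross_jacobi_component trunc_zero)
qed

lemma supported_mono: "p \<in> supported I \<Longrightarrow> I \<subseteq> K \<Longrightarrow> p \<in> supported K"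
  by (auto simp: supported_def)

lemmas supported_closed =
  subspace_add[OF subspace_supported] subspace_diff[OF subspace_supported]
  subspace_neg[OF subspace_supported] subspace_scale[OF subspace_supported]

text \<open>The parities follow the grading of \<open>so(3)\<close> modulo 2 with \<open>u\<close>,
  \<open>v\<close> odd and \<open>w\<close> even. The bound on \<open>s\<close> puts the positive
  even degrees up to \<open>s\<close> inside \<open>evens q\<close>.\<close>

lemma loop_bracket_closed:
  assumes s: "s \<le> 2 * q + 1" and xy: "x \<in> loop_algebra s q" "y \<in> loop_algebra s q"
  shows "loop_bracket s x y \<in> loop_algebra s q"
proof -
  obtain a b c a' b' c' where x: "x = (a, b, c)" and y: "y = (a', b', c')"
    by (metis prod_cases3)
  have mem: "a \<in> supported (odds s)" "b \<in> supported (odds s)" "c \<in> supported (evens q)"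
    "a' \<in> supported (odds s)" "b' \<in> supported (odds s)" "c' \<in> supported (evens q)"
    using xy by (auto simp: x y loop_algebra_def)
  have odd: "p * r \<in> supported {k. odd k}" "r * p \<in> supported {k. odd k}"
    if "p \<in> supported (odds s)" "r \<in> supported (evens q)" for p r
    using that by (auto intro!: supported_mult simp: odds_def evens_def)
  have even: "p * r \<in> supported {k. even k \<and> 0 < k}"
    if "p \<in> supported (odds s)" "r \<in> supported (odds s)" for p r
    using that by (rule supported_mult) (auto simp: odds_def odd_pos)
  have trunc_odd: "trunc s p \<in> supported (odds s)" if "p \<in> supported {k. odd k}" for p
    using trunc_supported[OF that] by (rule supported_mono) (auto simp: odds_def)
  have trunc_even: "trunc s p \<in> supported (evens q)" if "p \<in> supported {k. even k \<and> 0 < k}" for p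
    using trunc_supported[OF that] by (rule supported_mono) (use s in \<open>auto simp: evens_def elim!: evenE\<close>)
  show ?thesis
    using mem by (auto simp: x y loop_algebra_def
        intro!: trunc_odd trunc_even supported_closed(2) intro: odd even)
qed

lemma real_lie_algebra_loop:
  assumes "s \<le> 2 * q + 1"
  shows "real_lie_algebra (loop_algebra s q) (loop_bracket s)"
proof
  fix x y z :: "rpoly \<times> rpoly \<times> rpoly" and c :: real
  show "loop_bracket s (x + y) z = loop_bracket s x z + loop_bracket s y z"
    by (cases x; cases y; cases z) (simp add: trunc_add[symmetric] algebra_simps)
  show "loop_bracket s x (y + z) = loop_bracket s x y + loop_bracket s x z"
    by (cases x; cases y; cases z) (simp add: trunc_add[symmetric] algebra_simps)
  show "loop_bracket s (c *\<^sub>R x) y = c *\<^sub>R loop_bracket s x y"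
    by (cases x; cases y)
      (simp add: trunc_scaleR[symmetric] scaleR_diff_right mult_scaleR_left_rpoly mult_scaleR_right_rpoly)
  show "loop_bracket s x (c *\<^sub>R y) = c *\<^sub>R loop_bracket s x y"
    by (cases x; cases y)
      (simp add: trunc_scaleR[symmetric] scaleR_diff_right mult_scaleR_left_rpoly mult_scaleR_right_rpoly)
  show "loop_bracket s x x = 0"
    by (cases x) (simp add: mult.commute trunc_zero zero_prod_def)
  show "loop_bracket s x (loop_bracket s y z) + loop_bracket s y (loop_bracket s z x)
    + loop_bracket s z (loop_bracket s x y) = 0"
    by (rule loop_bracket_jacobi)
qed (rule subspace_loop_algebra loop_bracket_closed[OF assms]; assumption)+

section \<open>The complex structure on the loop algebra\<close>

definition partner :: "nat \<Rightarrow> nat" where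
  "partner k = (if k mod 4 = 2 then k + 2 else if 4 dvd k \<and> 0 < k then k - 2 else k)"

lemma partner_cases:
  obtains i where "k = 4 * i + 2" "partner k = 4 * i + 4"
  | i where "k = 4 * i + 4" "partner k = 4 * i + 2"
  | "k = 0 \<or> odd k" "partner k = k"
proof -
  have "k mod 4 = 2 \<or> k mod 4 = 0 \<and> k > 0 \<or> k = 0 \<or> odd k" by presburger
  then consider "k mod 4 = 2" | "k mod 4 = 0" "k > 0" | "k = 0" | "odd k" by metis
  then show thesis
  proof cases
    case 1
    then have "k = 4 * (k div 4) + 2" by presburger
    with 1 show thesis by (intro that(1)[of "k div 4"]) (auto simp: partner_def)
  next
    case 2
    then obtain i where "k = 4 * Suc i" by (metis dvd_def gr0_implies_Suc mod_0_imp_dvd mult_eq_0_iff not_gr0)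
    with 2 show thesis by (intro that(2)[of i]) (auto simp: partner_def)
  next
    case 3
    then show thesis by (intro that(3)) (auto simp: partner_def)
  next
    case 4
    then have "k mod 4 \<noteq> 2" "\<not> 4 dvd k" by presburger+
    with 4 show thesis by (intro that(3)) (auto simp: partner_def)
  qed
qed

text \<open>Fixing every degree outside the pairs \<open>4i+2\<close>, \<open>4i+4\<close> makes
  \<open>partner\<close> an involution of all naturals, hence injective, as evaluating
  \<open>map_key\<close> demands.\<close>

lemma partner_partner: "partner (partner k) = k"
proof (cases k rule: partner_cases)
  case (1 i)
  have "4 dvd 4 * i + 4" "(4 * i + 4) mod 4 \<noteq> 2" by presburger+
  with 1 show ?thesis by (simp add: partner_def)
next
  case (2 i)
  have "(4 * i + 2) mod 4 = 2" by presburger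
  with 2 show ?thesis by (simp add: partner_def)
qed simp

text \<open>Any complex structure on the abelian third component would do.\<close>
definition pairing :: "rpoly \<Rightarrow> rpoly" where
  "pairing p = Poly_Mapping.mapp (\<lambda>k c. if 4 dvd k then c else - c) (Poly_Mapping.map_key partner p)"

text \<open>Thus \<open>t^(4i+2)\<close> goes to \<open>t^(4i+4)\<close>, and
  \<open>t^(4i+4)\<close> to \<open>-t^(4i+2)\<close>.\<close>

lemma lookup_pairing:
  "Poly_Mapping.lookup (pairing p) k
    = (if 4 dvd k then 1 else - 1) * Poly_Mapping.lookup p (partner k)"
proof -
  have "inj partner" by (rule inj_on_inverseI[where g = partner]) (simp add: partner_partner)
  then have "Poly_Mapping.lookup (Poly_Mapping.map_key partner p) k = Poly_Mapping.lookup p (partner k)"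
    by (simp add: map_key.rep_eq)
  then show ?thesis by (simp add: pairing_def lookup_mapp when_def in_keys_iff)
qed

lemma pairing_add: "pairing (p + r) = pairing p + pairing r"
  and pairing_scaleR: "pairing (c *\<^sub>R p) = c *\<^sub>R pairing p"
  and pairing_uminus: "pairing (- p) = - pairing p"
  by (rule poly_mapping_eqI, simp add: lookup_pairing lookup_add lookup_scaleR)+

lemma pairing_zero: "pairing 0 = 0"
  using pairing_scaleR[of 0 0] by simp

text \<open>For even \<open>q\<close> the set \<open>evens q\<close> is a union of complete
  pairs.\<close>

lemma pairing_supported:
  assumes "even q" "p \<in> supported (evens q)"
  shows "pairing p \<in> supported (evens q)"
proof -
  have "k \<in> evens q" if "partner k \<in> evens q" for k
    using that assms(1)
    by (cases k rule: partner_cases) (auto simp: evens_def elim!: evenE, presburger)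
  then show ?thesis using assms(2) by (auto simp: supported_iff lookup_pairing)
qed

text \<open>In positive even degrees the two partners carry opposite signs.\<close>

lemma pairing_pairing:
  assumes "p \<in> supported (evens q)"
  shows "pairing (pairing p) = - p"
proof (rule poly_mapping_eqI)
  fix k
  show "Poly_Mapping.lookup (pairing (pairing p)) k = Poly_Mapping.lookup (- p) k"
  proof (cases "k \<in> evens q")
    case True
    have "4 dvd partner k \<longleftrightarrow> \<not> 4 dvd k"
    proof (cases k rule: partner_cases)
      case (1 i)
      have "4 dvd 4 * i + 4" "\<not> 4 dvd 4 * i + 2" by presburger+
      with 1 show ?thesis by simp
    next
      case (2 i)
      have "4 dvd 4 * i + 4" "\<not> 4 dvd 4 * i + 2" by presburger+
      with 2 show ?thesis by simp
    qed (use True in \<open>auto simp: evens_def\<close>)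
    then show ?thesis by (simp add: lookup_pairing partner_partner)
  next
    case False
    then show ?thesis using assms by (simp add: lookup_pairing partner_partner supported_iff)
  qed
qed

fun loop_J :: "rpoly \<times> rpoly \<times> rpoly \<Rightarrow> rpoly \<times> rpoly \<times> rpoly" where
  "loop_J (a, b, c) = (- b, a, pairing c)"

lemma complex_structure_loop:
  assumes "even q"
  shows "complex_structure (loop_algebra s q) (loop_bracket s) loop_J"
proof
  fix x y :: "rpoly \<times> rpoly \<times> rpoly" and c :: real
  show "loop_J x \<in> loop_algebra s q" if "x \<in> loop_algebra s q"
    using that assms by (cases x) (auto simp: loop_algebra_def intro: supported_closed pairing_supported)
  show "loop_J (x + y) = loop_J x + loop_J y"
    by (cases x; cases y) (simp add: pairing_add)
  show "loop_J (c *\<^sub>R x) = c *\<^sub>R loop_J x"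
    by (cases x) (simp add: pairing_scaleR)
  show "loop_J (loop_J x) = - x" if "x \<in> loop_algebra s q"
    using that by (cases x) (auto simp: loop_algebra_def pairing_pairing)
  \<comment> \<open>In the third component the two \<open>J\<close>-terms cancel before
    \<open>pairing\<close> acts; in the others the terms with \<open>pairing\<close> agree on both
    sides and the rest cancels.\<close>
  show "loop_bracket s (loop_J x) (loop_J y)
      = loop_bracket s x y + loop_J (loop_bracket s (loop_J x) y) + loop_J (loop_bracket s x (loop_J y))"
    by (cases x; cases y)
      (simp add: trunc_add[symmetric] trunc_diff[symmetric] trunc_uminus[symmetric]
        pairing_add[symmetric] pairing_uminus[symmetric] algebra_simps trunc_zero pairing_zero)
qed

section \<open>The nil-index of the loop algebra\<close>

lemma lower_central_loop_le:
  assumes "s \<le> 2 * q + 1" "k \<ge> 1"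
  shows "lower_central (loop_algebra s q) (loop_bracket s) k
    \<subseteq> supported {k..} \<times> supported {k..} \<times> supported {k..}"
  using assms(2)
proof (induction rule: dec_induct)
  case base
  show ?case
    by (auto simp: loop_algebra_def odds_def evens_def odd_pos elim!: supported_mono intro!: Suc_leI)
next
  case (step k)
  interpret real_lie_algebra "loop_algebra s q" "loop_bracket s"
    by (rule real_lie_algebra_loop) fact
  show ?case
  proof (rule lc_Suc_le)
    show "subspace (supported {Suc k..} \<times> supported {Suc k..} \<times> supported {Suc k..})"
      by (intro subspace_Times subspace_supported)
    fix x y assume x: "x \<in> loop_algebra s q" and y: "y \<in> lc k"
    obtain a b c a' b' c' where xy: "x = (a, b, c)" "y = (a', b', c')"
      by (metis prod_cases3)
    \<comment> \<open>Elements of the algebra have no constant term, so bracketing with them raises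
      the lowest degree by at least one.\<close>
    have 1: "a \<in> supported {1..}" "b \<in> supported {1..}" "c \<in> supported {1..}"
      using x by (auto simp: xy loop_algebra_def odds_def evens_def odd_pos elim!: supported_mono intro!: Suc_leI)
    have 2: "a' \<in> supported {k..}" "b' \<in> supported {k..}" "c' \<in> supported {k..}"
      using y step.IH by (auto simp: xy)
    have "trunc s (p * r - p' * r') \<in> supported {Suc k..}"
      if "p \<in> supported {1..}" "r \<in> supported {k..}" "p' \<in> supported {1..}" "r' \<in> supported {k..}"
      for p r p' r'
    proof -
      have "p * r \<in> supported {Suc k..}" "p' * r' \<in> supported {Suc k..}"
        using that by (auto elim!: supported_mult)
      then show ?thesis
        by (intro supported_mono[OF trunc_supported[OF supported_closed(2)]]) auto
    qed
    then show "loop_bracket s x y \<in> supported {Suc k..} \<times> supported {Suc k..} \<times> supported {Suc k..}"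
      using 1 2 by (simp add: xy)
  qed (use step in auto)
qed

text \<open>Brackets with \<open>u t\<close> and \<open>v t\<close> climb one degree at a time:
  \<open>[u t, v t^k] = w t^(k+1)\<close>, \<open>[v t, w t^k] = u t^(k+1)\<close>,
  \<open>[u t, w t^k] = -v t^(k+1)\<close>. Nothing is truncated up to degree
  \<open>s\<close>.\<close>

lemma lower_central_loop_ge:
  assumes "s \<le> 2 * q + 1" "1 \<le> k" "k \<le> s"
  shows "(if odd k
      then {(Poly_Mapping.single k 1, 0, 0), (0, Poly_Mapping.single k 1, 0)}
      else {(0, 0, Poly_Mapping.single k 1)})
    \<subseteq> lower_central (loop_algebra s q) (loop_bracket s) k"
  using assms(2,3)
proof (induction rule: dec_induct)
  case base
  then show ?case
    by (auto simp: loop_algebra_def supported_def odds_def)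
next
  case (step k)
  interpret real_lie_algebra "loop_algebra s q" "loop_bracket s"
    by (rule real_lie_algebra_loop) fact
  have u: "(Poly_Mapping.single 1 1, 0, 0) \<in> loop_algebra s q"
    and v: "(0, Poly_Mapping.single 1 1, 0) \<in> loop_algebra s q"
    using step.prems by (auto simp: loop_algebra_def supported_def odds_def)
  have IH: "(if odd k
      then {(Poly_Mapping.single k 1, 0, 0), (0, Poly_Mapping.single k 1, 0)}
      else {(0, 0, Poly_Mapping.single k 1)}) \<subseteq> lc k"
    using step by simp
  show ?case
  proof (cases "odd k")
    case True
    have "loop_bracket s (Poly_Mapping.single 1 1, 0, 0) (0, Poly_Mapping.single k 1, 0) \<in> lc (Suc k)"
      using IH True step by (intro bracket_lc u) auto
    then show ?thesis using True step.prems by (simp add: mult_single trunc_single trunc_zero)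
  next
    case False
    have "loop_bracket s (0, Poly_Mapping.single 1 1, 0) (0, 0, Poly_Mapping.single k 1) \<in> lc (Suc k)"
      using IH False step by (intro bracket_lc v) auto
    moreover have "- loop_bracket s (Poly_Mapping.single 1 1, 0, 0) (0, 0, Poly_Mapping.single k 1) \<in> lc (Suc k)"
      using IH False step by (intro lc_closed bracket_lc u) auto
    ultimately show ?thesis
      using False step.prems by (simp add: mult_single trunc_single trunc_zero trunc_uminus)
  qed
qed

lemma has_nil_index_loop:
  assumes "s \<le> 2 * q + 1" "s \<ge> 1"
  shows "has_nil_index (loop_algebra s q) (loop_bracket s) s"
proof -
  interpret real_lie_algebra "loop_algebra s q" "loop_bracket s"
    by (rule real_lie_algebra_loop) fact
  have "lc s \<noteq> {0}"
  proof
    assume "lc s = {0}"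
    then have "Poly_Mapping.single s (1::real) = 0"
      using lower_central_loop_ge[OF assms order.refl] by (auto simp: zero_prod_def split: if_splits)
    then show False by (metis lookup_single_eq lookup_zero zero_neq_one)
  qed
  moreover have "lc (s + 1) \<subseteq> {0}"
  proof -
    \<comment> \<open>The third component of the algebra may itself exceed degree \<open>s\<close>;
      it is the truncation in the bracket that bounds the degree here.\<close>
    have "lc (Suc s) \<subseteq> supported {..s} \<times> supported {..s} \<times> supported {..s}"
    proof (rule lc_Suc_le)
      show "subspace (supported {..s} \<times> supported {..s} \<times> supported {..s})"
        by (intro subspace_Times subspace_supported)
      show "loop_bracket s x y \<in> supported {..s} \<times> supported {..s} \<times> supported {..s}" for x y
        by (cases x; cases y) (auto simp: supported_iff lookup_trunc)
    qed (use assms in auto)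
    moreover have "lc (Suc s) \<subseteq> supported {Suc s..} \<times> supported {Suc s..} \<times> supported {Suc s..}"
      using assms by (intro lower_central_loop_le) auto
    moreover have "p = 0" if "p \<in> supported {..s}" "p \<in> supported {Suc s..}" for p
      using that by (intro poly_mapping_eqI) (metis atLeast_iff atMost_iff lookup_zero not_less_eq_eq supported_iff)
    ultimately show ?thesis by (fastforce simp: zero_prod_def)
  qed
  ultimately show ?thesis using zero_mem_lc[of "s + 1"] by (auto simp: has_nil_index_def)
qed

theorem theorem5p5:
  fixes n :: nat
  assumes "n \<ge> 1"
  shows "\<lfloor>4 * real n / 3\<rfloor> \<le> int (max_nil_index (2 * n))
    \<and> (n \<ge> 2 \<longrightarrow> int (max_nil_index (2 * n)) \<le> 2 * int n - 2)"
proof -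
  let ?S = "nil_indices TYPE(nat \<Rightarrow>\<^sub>0 real) (2 * n)"
  \<comment> \<open>\<open>s\<close> is the nil-index to be realised and \<open>q\<close> the
    dimension left for the third component, even so that \<open>pairing\<close> preserves that
    component.\<close>
  obtain s q where s: "s = 4 * n div 3" "s \<ge> 1"
    and dim: "2 * ((s + 1) div 2) + q = 2 * n" and sq: "s \<le> 2 * q + 1" and "even q"
  proof -
    define m where "m = n div 3"
    have "n = 3 * m \<or> n = 3 * m + 1 \<or> n = 3 * m + 2" unfolding m_def by presburger
    then consider "n = 3 * m" | "n = 3 * m + 1" | "n = 3 * m + 2" by blast
    then show ?thesis
    proof cases
      case 1
      then show ?thesis using that[of "4 * m" "2 * m"] assms by simp
    next
      case 2
      then show ?thesis
        by (intro that[of "4 * m + 1" "2 * m"]) presburger+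
    next
      \<comment> \<open>There are \<open>2 * m + 1\<close> positive even degrees up to
        \<open>s\<close>; the central monomial of degree \<open>4 * m + 4\<close> makes
        \<open>q\<close> even.\<close>
      case 3
      then show ?thesis
        by (intro that[of "4 * m + 2" "2 * m + 2"]) presburger+
    qed
  qed
  interpret loop: real_lie_algebra "loop_algebra s q" "loop_bracket s"
    by (rule real_lie_algebra_loop) (rule sq)
  have index: "has_nil_index (loop_algebra s q) (loop_bracket s) s"
    by (rule has_nil_index_loop[OF sq s(2)])
  have "s \<in> nil_indices TYPE(rpoly \<times> rpoly \<times> rpoly) (2 * n)"
    unfolding nil_indices_def
    using loop.real_lie_algebra_axioms loop.nil_index_eq[OF index] dim_loop_algebra[of s q] dim index
      complex_structure_loop[OF \<open>even q\<close>, of s]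
    by (auto simp: nilpotent_lie_def intro!: exI[of _ "loop_algebra s q"] exI[of _ "loop_bracket s"])
  then have s_mem: "s \<in> ?S" using nil_indices_subset[of "2 * n"] assms by auto
  \<comment> \<open>The first bound includes \<open>n = 1\<close> and yields the finiteness that
    \<open>Max\<close> requires.\<close>
  have bounds: "t \<le> 2 * n \<and> (n \<ge> 2 \<longrightarrow> t + 2 \<le> 2 * n)" if t_mem: "t \<in> ?S" for t
  proof -
    obtain L :: "(nat \<Rightarrow>\<^sub>0 real) set" and br J where t: "t = nil_index L br"
      and L: "real_lie_algebra L br" "dim L = 2 * n" "nilpotent_lie L br" "complex_structure L br J"
      using t_mem by (auto simp: nil_indices_def)
    interpret real_lie_algebra L br by fact
    have "has_nil_index L br t"
      using L(3) nil_index_eq t by (auto simp: nilpotent_lie_def)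
    then show ?thesis
      using nil_index_le_dim nil_index_le_dim_minus_2[OF _ _ L(4)] L(2) assms by fastforce
  qed
  then have fin: "finite ?S" by (meson finite_nat_set_iff_bounded_le)
  have "\<lfloor>4 * real n / 3\<rfloor> = int s"
    unfolding s(1) using floor_divide_of_nat_eq[of "4 * n" 3, where 'a = real] by simp
  also have "s \<le> max_nil_index (2 * n)"
    unfolding max_nil_index_def using fin s_mem by (rule Max_ge)
  finally have "\<lfloor>4 * real n / 3\<rfloor> \<le> int (max_nil_index (2 * n))" by simp
  moreover have "max_nil_index (2 * n) \<in> ?S"
    unfolding max_nil_index_def using fin s_mem by (intro Max_in) auto
  then have "n \<ge> 2 \<longrightarrow> int (max_nil_index (2 * n)) \<le> 2 * int n - 2"
    using bounds by fastforce
  ultimately show ?thesis by blast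
qed

end
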